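(* Consider the system of $N$ pulse-coupled oscillators with delayed excitatory coupling described in the context, with $0<\tau<1$, $0<\varepsilon<1$ and $f(\tau)+\varepsilon<1$. Let $i\neq j$ be oscillators satisfying $\varepsilon_{ij}=\varepsilon_{ji}$ and $\varepsilon_{ki}=\varepsilon_{kj}$ for all $k\in\{1,2,\dots,N\}\setminus\{i,j\}$. Then for any solution of the system and any integers $m_i,m_j\ge 1$: if $t^i_{m_i}\le t^j_{m_j}$, then $t^i_{m_i+1}\le t^j_{m_j+1}$ (i.e. the firing order of $i$ and $j$ is always preserved).
   Context: The system: $N$ identical oscillators $i=1,\dots,N$ have phases $\phi_i(t)\in[0,1]$, $t\ge 0$. $\mathrm{Pre}(i)$ is the set of oscillators sending pulses to $i$, and $\mathrm{Post}(i)$ is the set of oscillators receiving pulses from $i$ (so $j\in\mathrm{Post}(i)$ iff $i\in\mathrm{Pre}(j)$). The function $f:[0,1]\to[0,1]$ is twice continuously differentiable with $f'>0$, $f''<0$, $f(0)=0$, $f(1)=1$. Dynamics: (1) In the absence of interaction, $\mathrm{d}\phi_i/\mathrm{d}t=1$. (2) When $\phi_i(t)=1$, oscillator $i$ fires at time $t$ and its phase is reset instantly: $\phi_i(t^+)=0$. (3) If oscillator $i$ fires at time $t$, it emits a spike, which reaches every $j\in\mathrm{Post}(i)$ at time $t+\tau$ and induces the phase jump $\phi_j(t+\tau)=f^{-1}(\min[1,f(\phi_j((t+\tau)^-))+\varepsilon_{ij}])$, where $\varepsilon_{ij}>0$ is the coupling strength from $i$ to $j$. If several spikes reach $j$ at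 the same time, their strengths are added in this formula. (A phase brought to $1$ by a jump at time $s$ means that the oscillator fires at time $s$.) Convention: $\varepsilon_{ij}=0$ if $j\notin\mathrm{Post}(i)$. Standing assumptions: the system starts at time $t=0$ with initial phases $0<\phi_i(0)\le 1$, and no spikes emitted before time $0$ are present; there is no self-interaction, i.e. $i\notin\mathrm{Pre}(i)$; $0<\tau<1$; and for all $i$, $\sum_{j\in\mathrm{Pre}(i)}\varepsilon_{ji}=\varepsilon$ with $0<\varepsilon<1$. $t^i_m$ denotes the time at which oscillator $i$ fires for the $m$-th time ($m\ge1$). *)

theory Defs
  imports "HOL-Analysis.Analysis"
begin

text \<open>
  The oscillators are the elements of a finite type \<open>'n\<close>, so \<open>N = CARD('n)\<close>.
  \<open>eps i j\<close> is the coupling strength from \<open>i\<close> to \<open>j\<close>, and \<open>Pre i\<close> is the set of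
  oscillators sending pulses to \<open>i\<close>.
\<close>

definition rise_function :: "(real \<Rightarrow> real) \<Rightarrow> bool" where
  "rise_function f \<longleftrightarrow>
     f ` {0..1} \<subseteq> {0..1} \<and> f 0 = 0 \<and> f 1 = 1 \<and>
     (\<exists>f' f''.
        (\<forall>x\<in>{0..1}. (f has_real_derivative f' x) (at x within {0..1})) \<and>
        (\<forall>x\<in>{0..1}. (f' has_real_derivative f'' x) (at x within {0..1})) \<and>
        continuous_on {0..1} f'' \<and>
        (\<forall>x\<in>{0..1}. f' x > 0) \<and>
        (\<forall>x\<in>{0..1}. f'' x < 0))"

definition coupling_network ::
  "('n::finite \<Rightarrow> 'n set) \<Rightarrow> ('n \<Rightarrow> 'n \<Rightarrow> real) \<Rightarrow> real \<Rightarrow> bool" where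
  "coupling_network Pre eps \<epsilon> \<longleftrightarrow>
     (\<forall>i. i \<notin> Pre i) \<and>
     (\<forall>i j. i \<in> Pre j \<longrightarrow> eps i j > 0) \<and>
     (\<forall>i j. i \<notin> Pre j \<longrightarrow> eps i j = 0) \<and>
     (\<forall>i. (\<Sum>j\<in>Pre i. eps j i) = \<epsilon>)"

definition fires :: "('n \<Rightarrow> real \<Rightarrow> real) \<Rightarrow> 'n \<Rightarrow> real \<Rightarrow> bool" where
  "fires \<phi> i t \<longleftrightarrow> t \<ge> 0 \<and> \<phi> i t = 1"

text \<open>
  The oscillators whose spikes reach \<open>j\<close> at time \<open>t\<close>. As \<open>fires\<close> requires a nonnegative time,
  no spike emitted before time \<open>0\<close> is counted.
\<close>

definition arriving ::
  "('n \<Rightarrow> 'n set) \<Rightarrow> real \<Rightarrow> ('n \<Rightarrow> real \<Rightarrow> real) \<Rightarrow> 'n \<Rightarrow> real \<Rightarrow> 'n set" where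
  "arriving Pre \<tau> \<phi> j t = {i \<in> Pre j. fires \<phi> i (t - \<tau>)}"

text \<open>
  \<open>\<phi> i t\<close> is the phase after the spikes arriving at time \<open>t\<close> have acted but before a reset at
  time \<open>t\<close>; the left limit \<open>L\<close> below is \<open>\<phi> i (t\<^sup>-)\<close>, and the right limit is \<open>0\<close> exactly
  when \<open>i\<close> fires at \<open>t\<close>. A phase can thus reach \<open>1\<close> only by free evolution or by a
  spike-induced jump. The values of \<open>\<phi>\<close> at negative times are irrelevant.
\<close>

definition is_solution ::
  "(real \<Rightarrow> real) \<Rightarrow> ('n::finite \<Rightarrow> 'n set) \<Rightarrow> ('n \<Rightarrow> 'n \<Rightarrow> real) \<Rightarrow> real \<Rightarrow>
   ('n \<Rightarrow> real \<Rightarrow> real) \<Rightarrow> bool" where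
  "is_solution f Pre eps \<tau> \<phi> \<longleftrightarrow>
     (\<forall>i. 0 < \<phi> i 0 \<and> \<phi> i 0 \<le> 1) \<and>
     (\<forall>i. \<forall>t\<ge>0. \<phi> i t \<in> {0..1}) \<and>
     (\<forall>i. \<forall>t>0. \<not> fires \<phi> i t \<and> arriving Pre \<tau> \<phi> i t = {} \<longrightarrow>
        (\<phi> i has_real_derivative 1) (at t)) \<and>
     (\<forall>i. \<forall>t\<ge>0. (\<phi> i \<longlongrightarrow> (if fires \<phi> i t then 0 else \<phi> i t)) (at_right t)) \<and>
     (\<forall>i. \<forall>t>0. \<exists>L. (\<phi> i \<longlongrightarrow> L) (at_left t) \<and>
        \<phi> i t =
          (if arriving Pre \<tau> \<phi> i t = {} then L
           else inv_into {0..1} f (min 1 (f L + (\<Sum>k\<in>arriving Pre \<tau> \<phi> i t. eps k i)))))"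

text \<open>
  The time of the \<open>m\<close>-th firing of \<open>i\<close>, for \<open>m \<ge> 1\<close>. Since infinite sets have cardinality \<open>0\<close>,
  the condition entails that only finitely many firings occur up to time \<open>t\<close>.
\<close>

definition firing_time :: "('n \<Rightarrow> real \<Rightarrow> real) \<Rightarrow> 'n \<Rightarrow> nat \<Rightarrow> real" where
  "firing_time \<phi> i m = (THE t. fires \<phi> i t \<and> card {s. fires \<phi> i s \<and> s \<le> t} = m)"

end

theory Submission
  imports Defs
begin

text \<open>
  Suppose \<open>i\<close> fires at \<open>r\<close>, \<open>j\<close> fires at \<open>s \<ge> r\<close>, and \<open>i\<close> has not fired again up to \<open>s\<close>.
  Since \<open>f \<tau> + \<epsilon> < 1\<close>, an oscillator never fires twice within a time span of length \<open>\<tau>\<close>. Hence,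
  until the next firing of \<open>i\<close> or \<open>j\<close>, both receive the same inputs, except for at most one spike
  from \<open>i\<close> to \<open>j\<close> at \<open>r + \<tau>\<close> and one equally strong spike from \<open>j\<close> to \<open>i\<close> at
  \<open>s + \<tau> \<ge> r + \<tau>\<close>. By concavity of \<open>f\<close> the first spike can put \<open>j\<close> ahead by at most its own
  strength (measured in \<open>f\<close>), and free evolution does not increase this advance, so the second spike
  compensates it. As \<open>j\<close> cannot fire again before \<open>s + \<tau>\<close>, it cannot overtake \<open>i\<close>.
\<close>

section \<open>Induction and integration on real intervals\<close>

text \<open>At the infimum \<open>c\<close> of the counterexamples, \<open>left\<close> yields
  \<open>P c\<close>, and then \<open>right\<close> (or \<open>start\<close>, if
  \<open>c = a\<close>) extends validity beyond \<open>c\<close>. Later \<open>left\<close> treats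
  jumps and \<open>right\<close> free evolution.\<close>

lemma real_interval_induct:
  fixes a b :: real
  assumes "a < b"
    and start: "eventually P (at_right a)"
    and left: "\<And>t. a < t \<Longrightarrow> t \<le> b \<Longrightarrow> (\<And>u. a < u \<Longrightarrow> u < t \<Longrightarrow> P u) \<Longrightarrow> P t"
    and right: "\<And>t. a < t \<Longrightarrow> t < b \<Longrightarrow> P t \<Longrightarrow> eventually P (at_right t)"
    and "a < t" "t \<le> b"
  shows "P t"
proof (rule ccontr)
  assume "\<not> P t"
  define X where "X = {u. a < u \<and> u \<le> b \<and> \<not> P u}"
  define c where "c = Inf X"
  have X: "t \<in> X" "bdd_below X"
    using \<open>\<not> P t\<close> assms(5,6) by (auto simp: X_def bdd_below_def intro!: exI[of _ a])
  have "a \<le> c"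
    unfolding c_def using X(1) by (intro cInf_greatest) (auto simp: X_def)
  have "c \<le> t"
    unfolding c_def using X by (intro cInf_lower)
  have below: "P u" if "a < u" "u < c" for u
    using that cInf_lower[OF _ X(2), of u] \<open>c \<le> t\<close> \<open>t \<le> b\<close>
    by (force simp: X_def c_def)
  have right_c: "\<not> eventually P (at_right c)"
  proof
    assume "eventually P (at_right c)"
    then obtain d where d: "d > c" "\<And>u. c < u \<Longrightarrow> u < d \<Longrightarrow> P u"
      by (auto simp: eventually_at_right_field)
    obtain u where "u \<in> X" "u < d"
      using d(1) X cInf_lessD[of X d] unfolding c_def by blast
    moreover have "c \<le> u"
      unfolding c_def using X \<open>u \<in> X\<close> by (intro cInf_lower)
    ultimately have "u = c"
      using d(2)[of u] by (force simp: X_def)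
    then show False
      using \<open>u \<in> X\<close> left[of c] below by (auto simp: X_def)
  qed
  then have "a < c"
    using start \<open>a \<le> c\<close> by (cases "a = c") auto
  then have "P c"
    using left[of c] below \<open>c \<le> t\<close> \<open>t \<le> b\<close> by auto
  then have "c \<noteq> t"
    using \<open>\<not> P t\<close> by auto
  then show False
    using right[OF \<open>a < c\<close> _ \<open>P c\<close>] right_c \<open>c \<le> t\<close> \<open>t \<le> b\<close> by auto
qed

lemma unit_slope_constant:
  fixes g :: "real \<Rightarrow> real"
  assumes "\<And>u. a < u \<Longrightarrow> u < b \<Longrightarrow> (g has_real_derivative 1) (at u)"
  obtains c where "\<And>u. a < u \<Longrightarrow> u < b \<Longrightarrow> g u = u + c"
proof -
  have "((\<lambda>u. g u - u) has_field_derivative 0) (at u within {a<..<b})" if "u \<in> {a<..<b}" for u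
  proof (rule has_field_derivative_at_within)
    have "((\<lambda>u. g u - u) has_field_derivative 1 - 1) (at u)"
      by (rule DERIV_diff[OF assms DERIV_ident]) (use that in simp_all)
    then show "((\<lambda>u. g u - u) has_field_derivative 0) (at u)" by simp
  qed
  then obtain c where "\<forall>u\<in>{a<..<b}. g u - u = c"
    using has_field_derivative_zero_constant[of "{a<..<b}" "\<lambda>u. g u - u"] by auto
  then show thesis
    by (intro that[of c]) (auto simp: algebra_simps)
qed

subsection \<open>Rise functions\<close>

lemma rise_function_continuous:
  assumes "rise_function f"
  shows "continuous_on {0..1} f"
  using assms unfolding rise_function_def
  by (meson DERIV_continuous continuous_on_eq_continuous_within)

lemma rise_function_surj:
  assumes "rise_function f"
  shows "f ` {0..1} = {0..1}"
proof
  show "f ` {0..1} \<subseteq> {0..1}"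
    using assms by (auto simp: rise_function_def)
  show "{0..1} \<subseteq> f ` {0..1}"
  proof
    fix y :: real
    assume "y \<in> {0..1}"
    then show "y \<in> f ` {0..1}"
      using IVT'[of f 0 y 1] rise_function_continuous[OF assms] assms
      by (force simp: rise_function_def)
  qed
qed

lemma rise_function_strict_mono:
  assumes "rise_function f" "0 \<le> u" "u < v" "v \<le> 1"
  shows "f u < f v"
proof -
  obtain f' where f': "\<forall>x\<in>{0..1}. (f has_real_derivative f' x) (at x within {0..1})"
      "\<forall>x\<in>{0..1}. f' x > 0"
    using assms(1) by (auto simp: rise_function_def)
  have "continuous_on {u..v} f"
    using rise_function_continuous[OF assms(1)] by (rule continuous_on_subset) (use assms in auto)
  moreover have "\<exists>y. (f has_real_derivative y) (at x) \<and> y > 0" if "u < x" "x < v" for x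
    using f' that assms at_within_Icc_at[of 0 x 1]
    by (metis atLeastAtMost_iff less_eq_real_def order.strict_trans1 order.strict_trans2)
  ultimately show ?thesis
    using DERIV_pos_imp_increasing_open[of u v f] assms by auto
qed

lemma rise_function_mono:
  assumes "rise_function f" "0 \<le> u" "u \<le> v" "v \<le> 1"
  shows "f u \<le> f v"
  using rise_function_strict_mono[OF assms(1), of u v] assms by (cases "u = v") auto

text \<open>Since \<open>f'' < 0\<close>, \<open>f'\<close> decreases, so
  \<open>f (v + z) - f (u + z)\<close> has nonpositive derivative in \<open>z\<close>.\<close>

lemma rise_function_concave_increment:
  assumes "rise_function f" "0 \<le> u" "u \<le> v" "0 \<le> h" "v + h \<le> 1"
  shows "f (v + h) - f v \<le> f (u + h) - f u"
proof -
  obtain f' f'' where f': "\<forall>x\<in>{0..1}. (f has_real_derivative f' x) (at x within {0..1})"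
      "\<forall>x\<in>{0..1}. (f' has_real_derivative f'' x) (at x within {0..1})"
      "\<forall>x\<in>{0..1}. f'' x < 0"
    using assms(1) by (auto simp: rise_function_def)
  have interior: "(f has_real_derivative f' x) (at x)" "(f' has_real_derivative f'' x) (at x)"
      "f'' x < 0" if "0 < x" "x < 1" for x
  proof -
    have "x \<in> {0..1}" using that by auto
    with f' show "(f has_real_derivative f' x) (at x)" "(f' has_real_derivative f'' x) (at x)"
        "f'' x < 0"
      unfolding at_within_Icc_at[OF that, symmetric] by blast+
  qed
  have "continuous_on {0..1} f'"
    using f'(2) by (meson DERIV_continuous continuous_on_eq_continuous_within)
  have f'_anti: "f' y \<le> f' x" if "0 \<le> x" "x \<le> y" "y \<le> 1" for x y
  proof (rule DERIV_nonpos_imp_decreasing_open[OF that(2)])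
    show "\<exists>d. (f' has_real_derivative d) (at z) \<and> d \<le> 0" if "x < z" "z < y" for z
      using interior[of z] that \<open>0 \<le> x\<close> \<open>y \<le> 1\<close> by (intro exI[of _ "f'' z"]) auto
    show "continuous_on {x..y} f'"
      by (rule continuous_on_subset[OF \<open>continuous_on {0..1} f'\<close>]) (use that in auto)
  qed
  have contf: "continuous_on {0..1} f"
    by (rule rise_function_continuous[OF assms(1)])
  let ?G = "\<lambda>z. f (v + z) - f (u + z)"
  have "?G h \<le> ?G 0"
  proof (rule DERIV_nonpos_imp_decreasing_open[OF \<open>0 \<le> h\<close>])
    fix z assume z: "0 < z" "z < h"
    have "((\<lambda>z. f (c + z)) has_real_derivative f' (c + z)) (at z)" if "0 \<le> c" "c + h \<le> 1" for c
      using DERIV_shift[of f "f' (c + z)" z c] interior(1)[of "c + z"] that z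
      by (simp add: add.commute)
    then have "(?G has_real_derivative f' (v + z) - f' (u + z)) (at z)"
      using assms by (intro DERIV_diff) simp_all
    moreover have "f' (v + z) - f' (u + z) \<le> 0"
      using f'_anti[of "u + z" "v + z"] z assms by auto
    ultimately show "\<exists>y. (?G has_real_derivative y) (at z) \<and> y \<le> 0"
      by blast
  next
    show "continuous_on {0..h} ?G"
      using assms
      by (intro continuous_on_diff continuous_on_compose2[OF contf]
          continuous_on_add continuous_on_const continuous_on_id) auto
  qed
  then show ?thesis by simp
qed

text \<open>If \<open>v\<close> is ahead, concavity shrinks the gap; otherwise monotonicity keeps
  \<open>v + h\<close> behind \<open>u + h\<close>, and \<open>c \<ge> 0\<close> suffices.\<close>

lemma rise_function_gap_shift:
  assumes f: "rise_function f"
    and u: "0 \<le> u" "u + h \<le> 1" and v: "0 \<le> v" "v + h \<le> 1" and "0 \<le> h" "0 \<le> c"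
    and gap: "f v \<le> f u + c"
  shows "f (v + h) \<le> f (u + h) + c"
proof (cases "u \<le> v")
  case True
  then show ?thesis
    using rise_function_concave_increment[OF f, of u v h] assms by auto
next
  case False
  then show ?thesis
    using rise_function_mono[OF f, of "v + h" "u + h"] assms by auto
qed

subsection \<open>Phases driven by inputs\<close>

text \<open>Models a phase between two resets, so that solutions and the idealized free run fall
  under one comparison lemma. Nothing is required at \<open>a\<close>, nor to the right of
  \<open>b\<close>, where resets may occur.\<close>

definition driven :: "(real \<Rightarrow> real) \<Rightarrow> real \<Rightarrow> real \<Rightarrow> (real \<Rightarrow> real) \<Rightarrow> (real \<Rightarrow> real) \<Rightarrow> bool" where
  "driven f a b x S \<longleftrightarrow>
     (\<forall>t. a < t \<and> t \<le> b \<longrightarrow> x t \<in> {0..1}) \<and>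
     (\<forall>t. a < t \<and> t < b \<longrightarrow> eventually (\<lambda>u. x u = x t + (u - t)) (at_right t)) \<and>
     (\<forall>t. a < t \<and> t \<le> b \<longrightarrow>
        (\<exists>L\<in>{0..1}. (x \<longlongrightarrow> L) (at_left t) \<and> f (x t) = min 1 (f L + S t)))"

lemma driven_free_run:
  assumes "rise_function f" "b \<le> a + 1"
  shows "driven f a b (\<lambda>t. t - a) (\<lambda>_. 0)"
  unfolding driven_def
proof (intro conjI allI impI)
  fix t assume t: "a < t \<and> t \<le> b"
  then show "\<exists>L\<in>{0..1}. ((\<lambda>t. t - a) \<longlongrightarrow> L) (at_left t) \<and> f (t - a) = min 1 (f L + 0)"
    using assms rise_function_surj[OF assms(1)] imageI[of "t - a" "{0..1}" f]
    by (intro bexI[of _ "t - a"]) (auto intro!: tendsto_intros simp: min_def)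
qed (use assms in auto)

text \<open>
  \<open>C\<close> bounds the advance of \<open>y\<close> over \<open>x\<close> measured in \<open>f\<close>. By concavity free evolution does not
  increase a positive advance, so \<open>C\<close> only has to account for the difference of the inputs.
\<close>

lemma driven_comparison:
  assumes f: "rise_function f" and "a < b"
    and x: "driven f a b x Sx" and y: "driven f a b y Sy"
    and C: "\<And>t. 0 \<le> C t"
    and start: "eventually (\<lambda>t. f (y t) \<le> f (x t) + C t) (at_right a)"
    and right: "\<And>t. a < t \<Longrightarrow> t < b \<Longrightarrow> eventually (\<lambda>u. C t \<le> C u) (at_right t)"
    and left: "\<And>t. a < t \<Longrightarrow> t \<le> b \<Longrightarrow> eventually (\<lambda>u. C u + Sy t \<le> C t + Sx t) (at_left t)"
    and "a < t" "t \<le> b"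
  shows "f (y t) \<le> f (x t) + C t"
proof (rule real_interval_induct[OF \<open>a < b\<close> start _ _ \<open>a < t\<close> \<open>t \<le> b\<close>])
  fix t assume t: "a < t" "t < b" "f (y t) \<le> f (x t) + C t"
  have "eventually (\<lambda>u. x u = x t + (u - t)) (at_right t)"
       "eventually (\<lambda>u. y u = y t + (u - t)) (at_right t)"
    using x y t by (auto simp: driven_def)
  moreover have "eventually (\<lambda>u. t < u \<and> u < b) (at_right t)"
    using t by (auto simp: eventually_at_right_field)
  ultimately show "eventually (\<lambda>u. f (y u) \<le> f (x u) + C u) (at_right t)"
    using right[OF t(1,2)]
  proof eventually_elim
    case (elim u)
    have "x t \<in> {0..1}" "y t \<in> {0..1}" "x u \<in> {0..1}" "y u \<in> {0..1}"
      using x y t elim(3) by (auto simp: driven_def)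
    then have "f (y t + (u - t)) \<le> f (x t + (u - t)) + C t"
      using elim t C by (intro rise_function_gap_shift[OF f]) auto
    then show ?case using elim by auto
  qed
next
  fix t assume t: "a < t" "t \<le> b" and IH: "\<And>u. a < u \<Longrightarrow> u < t \<Longrightarrow> f (y u) \<le> f (x u) + C u"
  obtain Lx where Lx: "Lx \<in> {0..1}" "(x \<longlongrightarrow> Lx) (at_left t)" "f (x t) = min 1 (f Lx + Sx t)"
    using x t by (auto simp: driven_def)
  obtain Ly where Ly: "Ly \<in> {0..1}" "(y \<longlongrightarrow> Ly) (at_left t)" "f (y t) = min 1 (f Ly + Sy t)"
    using y t by (auto simp: driven_def)
  have ev: "eventually (\<lambda>u. a < u \<and> u < t) (at_left t)"
    using t by (auto simp: eventually_at_left_field)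
  have "((\<lambda>u. f (x u)) \<longlongrightarrow> f Lx) (at_left t)" "((\<lambda>u. f (y u)) \<longlongrightarrow> f Ly) (at_left t)"
    using x y t Lx Ly
    by (auto intro!: continuous_on_tendsto_compose[OF rise_function_continuous[OF f]]
          eventually_mono[OF ev] simp: driven_def)
  \<comment> \<open>The bound before the jump is rewritten with a constant right-hand offset, so
    that it survives the limit. Adding the inputs then leaves exactly \<open>C t\<close>, and
    clipping at 1 is harmless as \<open>C t \<ge> 0\<close>.\<close>
  moreover have "eventually (\<lambda>u. f (y u) \<le> f (x u) + (C t + Sx t - Sy t)) (at_left t)"
    using left[OF t] ev
  proof eventually_elim
    case (elim u)
    then show ?case using IH[of u] by auto
  qed
  ultimately have "f Ly \<le> f Lx + (C t + Sx t - Sy t)"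
    by (intro tendsto_le[OF trivial_limit_at_left_real]) (auto intro!: tendsto_intros)
  then show "f (y t) \<le> f (x t) + C t"
    using Lx(3) Ly(3) C[of t] by auto
qed

subsection \<open>Solutions\<close>

locale oscillator_solution =
  fixes f :: "real \<Rightarrow> real" and Pre :: "'n::finite \<Rightarrow> 'n set"
    and eps :: "'n \<Rightarrow> 'n \<Rightarrow> real" and \<epsilon> \<tau> :: real and \<phi> :: "'n \<Rightarrow> real \<Rightarrow> real"
  assumes rise: "rise_function f"
    and network: "coupling_network Pre eps \<epsilon>"
    and delay: "0 < \<tau>" "\<tau> < 1"
    and weak: "f \<tau> + \<epsilon> < 1"
    and solution: "is_solution f Pre eps \<tau> \<phi>"
begin

text \<open>The index set does not depend on the receiver, which eases comparing two receivers;
  senders outside \<open>Pre i\<close> contribute 0.\<close>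

definition input :: "'n \<Rightarrow> real \<Rightarrow> real" where
  "input i t = (\<Sum>k | fires \<phi> k (t - \<tau>). eps k i)"

lemma eps_nonneg: "0 \<le> eps k i"
  using network unfolding coupling_network_def by (metis less_eq_real_def)

lemma sum_eps: "(\<Sum>k\<in>UNIV. eps k i) = \<epsilon>"
proof -
  have "(\<Sum>k\<in>UNIV. eps k i) = (\<Sum>k\<in>Pre i. eps k i)"
    using network by (intro sum.mono_neutral_right) (auto simp: coupling_network_def)
  then show ?thesis using network by (simp add: coupling_network_def)
qed

lemma sum_arriving: "(\<Sum>k\<in>arriving Pre \<tau> \<phi> i t. eps k i) = input i t"
  unfolding input_def arriving_def
  using network by (intro sum.mono_neutral_left) (auto simp: coupling_network_def)

lemma input_nonneg: "0 \<le> input i t"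
  unfolding input_def by (intro sum_nonneg eps_nonneg)

lemma phase_bounds: "0 \<le> t \<Longrightarrow> \<phi> i t \<in> {0..1}"
  using solution unfolding is_solution_def by blast

lemma phase_right_limit:
  "0 \<le> t \<Longrightarrow> (\<phi> i \<longlongrightarrow> (if fires \<phi> i t then 0 else \<phi> i t)) (at_right t)"
  using solution unfolding is_solution_def by blast

text \<open>Applying \<open>f\<close> to the jump rule removes the inverse and merges its two cases:
  without arrivals the input is 0 and \<open>f L \<le> 1\<close>.\<close>

lemma phase_left_limit:
  assumes "0 < t"
  obtains L where "L \<in> {0..1}" "(\<phi> i \<longlongrightarrow> L) (at_left t)" "f (\<phi> i t) = min 1 (f L + input i t)"
proof -
  obtain L where L: "(\<phi> i \<longlongrightarrow> L) (at_left t)"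
    "\<phi> i t = (if arriving Pre \<tau> \<phi> i t = {} then L
           else inv_into {0..1} f (min 1 (f L + input i t)))"
    using solution assms unfolding is_solution_def sum_arriving by metis
  have "eventually (\<lambda>u. \<phi> i u \<in> {0..1}) (at_left t)"
    using eventually_at_left_real[OF assms] by eventually_elim (use phase_bounds in auto)
  then have L01: "L \<in> {0..1}"
    using L(1) by (intro Lim_in_closed_set[of "{0..1}"]) auto
  then have fL: "f L \<in> {0..1}"
    using rise_function_surj[OF rise] by blast
  have "f (\<phi> i t) = min 1 (f L + input i t)"
  proof (cases "arriving Pre \<tau> \<phi> i t = {}")
    case True
    then show ?thesis
      using L(2) fL sum_arriving[of i t] by (simp add: min_def)
  next
    case False
    have "min 1 (f L + input i t) \<in> f ` {0..1}"
      using fL input_nonneg[of i t] rise_function_surj[OF rise] by auto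
    then show ?thesis
      using L(2) False f_inv_into_f[of _ f "{0..1}"] by simp
  qed
  then show thesis using that L01 L(1) by blast
qed

section \<open>Isolation of firings and free evolution\<close>

lemma eventually_no_fire_right:
  assumes "0 \<le> t"
  shows "eventually (\<lambda>u. \<not> fires \<phi> i u) (at_right t)"
proof -
  have "(if fires \<phi> i t then 0 else \<phi> i t) < 1"
    using phase_bounds[OF assms, of i] assms by (auto simp: fires_def)
  then have "eventually (\<lambda>u. \<phi> i u < 1) (at_right t)"
    using order_tendstoD(2)[OF phase_right_limit[OF assms, of i]] by blast
  then show ?thesis by eventually_elim (auto simp: fires_def)
qed

lemma eventually_no_fire_left:
  assumes "0 < t"
  shows "eventually (\<lambda>u. \<not> fires \<phi> i u) (at_left t)"
proof -
  obtain L where L: "L \<in> {0..1}" "(\<phi> i \<longlongrightarrow> L) (at_left t)"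
    using phase_left_limit[OF assms] by metis
  show ?thesis
  proof (cases "L < 1")
    case True
    then have "eventually (\<lambda>u. \<phi> i u < 1) (at_left t)"
      using order_tendstoD(2)[OF L(2)] by blast
    then show ?thesis by eventually_elim (auto simp: fires_def)
  next
    case False
    \<comment> \<open>The phase stays above \<open>1/2\<close> just before \<open>t\<close>, which leaves no room for a reset.\<close>
    then have "eventually (\<lambda>u. \<phi> i u > 1/2) (at_left t)"
      using order_tendstoD(1)[OF L(2), of "1/2"] by auto
    then obtain d where d: "d < t" "\<And>u. d < u \<Longrightarrow> u < t \<Longrightarrow> \<phi> i u > 1/2"
      by (auto simp: eventually_at_left_field)
    have "\<not> fires \<phi> i u" if u: "d < u" "u < t" for u
    proof
      assume fire: "fires \<phi> i u"
      then have "(\<phi> i \<longlongrightarrow> 0) (at_right u)"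
        using phase_right_limit[of u i] by (auto simp: fires_def)
      then have "eventually (\<lambda>v. \<phi> i v < 1/2) (at_right u)"
        using order_tendstoD(2)[of "\<phi> i" 0 _ "1/2"] by auto
      then have "eventually (\<lambda>v. False) (at_right u)"
        using eventually_at_right_real[OF u(2)]
      proof eventually_elim
        case (elim v)
        then show ?case using d(2)[of v] u by auto
      qed
      then show False by simp
    qed
    then show ?thesis
      using d(1) by (auto simp: eventually_at_left_field)
  qed
qed

lemma eventually_no_arrival_right:
  assumes "0 \<le> t"
  shows "eventually (\<lambda>u. arriving Pre \<tau> \<phi> i u = {}) (at_right t)"
proof -
  have "eventually (\<lambda>u. \<not> fires \<phi> k (u - \<tau>)) (at_right t)" for k
  proof (cases "t < \<tau>")
    case True
    then show ?thesis
      \<comment> \<open>Before time \<open>\<tau>\<close>, an arriving spike would have been emitted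
        at a negative time.\<close>
      by (auto simp: eventually_at_right_field fires_def intro!: exI[of _ \<tau>])
  next
    case False
    have "filterlim (\<lambda>u. u - \<tau>) (at_right (t - \<tau>)) (at_right t)"
      by (auto simp: filterlim_at eventually_at_filter intro!: tendsto_intros)
    then show ?thesis
      using eventually_compose_filterlim eventually_no_fire_right[of "t - \<tau>" k] False by fastforce
  qed
  then have "eventually (\<lambda>u. \<forall>k. \<not> fires \<phi> k (u - \<tau>)) (at_right t)"
    by (intro eventually_all_finite)
  then show ?thesis by eventually_elim (auto simp: arriving_def)
qed

text \<open>Shortly after \<open>t\<close> nothing fires or arrives, so the phase is
  \<open>u + c\<close>; the right limit at \<open>t\<close> determines \<open>c\<close>.\<close>

lemma eventually_free_run:
  assumes "0 \<le> t"
  shows "eventually (\<lambda>u. \<phi> i u = (if fires \<phi> i t then 0 else \<phi> i t) + (u - t)) (at_right t)"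
    (is "eventually (\<lambda>u. _ = ?R + _) _")
proof -
  have "eventually (\<lambda>u. \<not> fires \<phi> i u \<and> arriving Pre \<tau> \<phi> i u = {}) (at_right t)"
    using eventually_no_fire_right[OF assms] eventually_no_arrival_right[OF assms]
    by eventually_elim auto
  then obtain d where d: "t < d"
    "\<And>u. t < u \<Longrightarrow> u < d \<Longrightarrow> \<not> fires \<phi> i u \<and> arriving Pre \<tau> \<phi> i u = {}"
    by (auto simp: eventually_at_right_field)
  then have "(\<phi> i has_real_derivative 1) (at u)" if "t < u" "u < d" for u
    using solution that assms unfolding is_solution_def by (meson le_less_trans)
  then obtain c where c: "\<And>u. t < u \<Longrightarrow> u < d \<Longrightarrow> \<phi> i u = u + c"
    using unit_slope_constant by blast
  have near: "eventually (\<lambda>u. \<phi> i u = u + c) (at_right t)"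
    using eventually_at_right_real[OF d(1)] by eventually_elim (use c in auto)
  have "((\<lambda>u. u + c) \<longlongrightarrow> t + c) (at_right t)"
    by (intro tendsto_intros)
  moreover have "((\<lambda>u. u + c) \<longlongrightarrow> ?R) (at_right t)"
    using Lim_transform_eventually[OF phase_right_limit[OF assms] near] .
  ultimately have "t + c = ?R"
    by (intro tendsto_unique[OF trivial_limit_at_right_real])
  then show ?thesis
    using near by (auto elim!: eventually_mono)
qed

lemma driven_phase:
  assumes "0 \<le> a" and quiet: "\<And>t. a < t \<Longrightarrow> t < b \<Longrightarrow> \<not> fires \<phi> i t"
  shows "driven f a b (\<phi> i) (input i)"
  unfolding driven_def
proof (intro conjI allI impI)
  fix t assume t: "a < t \<and> t < b"
  show "eventually (\<lambda>u. \<phi> i u = \<phi> i t + (u - t)) (at_right t)"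
    using eventually_free_run[of t i] quiet[of t] t assms(1) by auto
next
  fix t assume t: "a < t \<and> t \<le> b"
  then show "\<exists>L\<in>{0..1}. (\<phi> i \<longlongrightarrow> L) (at_left t) \<and> f (\<phi> i t) = min 1 (f L + input i t)"
    using phase_left_limit[of t i] assms(1) by (metis le_less_trans)
qed (use assms phase_bounds in auto)

text \<open>Infinitely many firings would accumulate in the compact interval \<open>{0..t}\<close>,
  but every point has a punctured neighbourhood without firings.\<close>

lemma finite_firings: "finite {s. fires \<phi> i s \<and> s \<le> t}"
proof (rule ccontr)
  let ?F = "{s. fires \<phi> i s \<and> s \<le> t}"
  assume "infinite ?F"
  moreover have "?F \<subseteq> {0..t}" by (auto simp: fires_def)
  ultimately obtain x where x: "x \<in> {0..t}" "x islimpt ?F"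
    using compact_Icc[of 0 t] unfolding compact_eq_Bolzano_Weierstrass by blast
  have "eventually (\<lambda>u. \<not> fires \<phi> i u) (at_left x)"
  proof (cases "x = 0")
    case True
    then show ?thesis
      by (auto simp: eventually_at_left_field fires_def intro!: exI[of _ "-1"])
  next
    case False
    then show ?thesis using x eventually_no_fire_left by auto
  qed
  then have "eventually (\<lambda>u. \<not> fires \<phi> i u) (at x)"
    using eventually_no_fire_right[of x i] x by (simp add: eventually_at_split)
  then have "eventually (\<lambda>u. u \<notin> ?F) (at x)"
    by eventually_elim auto
  then show False
    using x(2) by (simp add: islimpt_iff_eventually)
qed

lemma next_firing:
  assumes "fires \<phi> i s" "a < s"
  obtains b where "a < b" "b \<le> s" "fires \<phi> i b" "\<And>t. a < t \<Longrightarrow> t < b \<Longrightarrow> \<not> fires \<phi> i t"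
proof -
  let ?X = "{t. fires \<phi> i t \<and> t \<le> s} \<inter> {a<..}"
  have X: "finite ?X" "?X \<noteq> {}"
    using finite_firings assms by auto
  then have "Min ?X \<in> ?X" by (rule Min_in)
  moreover have "\<not> fires \<phi> i t" if "a < t" "t < Min ?X" for t
  proof
    assume "fires \<phi> i t"
    then have "t \<in> ?X"
      using that \<open>Min ?X \<in> ?X\<close> by auto
    then show False
      using Min_le[OF X(1)] that by fastforce
  qed
  ultimately show thesis
    using that[of "Min ?X"] by auto
qed

section \<open>Upper and lower bounds on the time between firings\<close>

text \<open>Inputs only advance the phase, so a silent oscillator stays at or above the free run
  started from 0 at \<open>a\<close>, which reaches 1 at \<open>a + 1\<close>.\<close>

lemma fires_within_unit_time:
  assumes "0 \<le> a"
  obtains s where "a < s" "s \<le> a + 1" "fires \<phi> i s"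
proof (rule ccontr)
  assume "\<not> thesis"
  then have quiet: "\<not> fires \<phi> i s" if "a < s" "s \<le> a + 1" for s
    using \<open>\<And>s. a < s \<Longrightarrow> s \<le> a + 1 \<Longrightarrow> fires \<phi> i s \<Longrightarrow> thesis\<close> that by blast
  have "f (a + 1 - a) \<le> f (\<phi> i (a + 1)) + 0"
  proof (rule driven_comparison[OF rise _ driven_phase driven_free_run[OF rise], of a "a + 1"])
    show "eventually (\<lambda>t. f (t - a) \<le> f (\<phi> i t) + 0) (at_right a)"
      using eventually_free_run[OF assms, of i] eventually_at_right_real[of a "a + 1", simplified]
    proof eventually_elim
      case (elim t)
      have "t - a \<le> \<phi> i t"
        using elim phase_bounds[OF assms, of i] by auto
      then show ?case
        using elim phase_bounds[of t i] assms by (auto intro!: rise_function_mono[OF rise])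
    qed
  qed (use assms quiet input_nonneg in auto)
  then have "\<not> \<phi> i (a + 1) < 1"
    using rise_function_strict_mono[OF rise, of "\<phi> i (a + 1)" 1] phase_bounds[of "a + 1" i] assms
    by auto
  then show False
    using quiet[of "a + 1"] phase_bounds[of "a + 1" i] assms by (auto simp: fires_def)
qed

text \<open>
  If no oscillator sends two spikes within the relevant window of length \<open>\<tau>\<close>, then the inputs
  received since the last reset sum up to at most \<open>\<epsilon>\<close>, and a phase \<open>u\<close> time units after the reset
  is at most \<open>f\<^sup>-\<^sup>1(f u + \<epsilon>)\<close>.
\<close>

lemma consecutive_gap:
  assumes r: "fires \<phi> i r" "fires \<phi> i b" "r < b"
    and quiet: "\<And>t. r < t \<Longrightarrow> t < b \<Longrightarrow> \<not> fires \<phi> i t"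
    and once: "\<And>k u v. r - \<tau> < u \<Longrightarrow> u < v \<Longrightarrow> v \<le> b - \<tau> \<Longrightarrow> fires \<phi> k u \<Longrightarrow> \<not> fires \<phi> k v"
  shows "\<tau> < b - r"
proof (rule ccontr)
  assume "\<not> \<tau> < b - r"
  then have "b \<le> r + \<tau>" by auto
  have "0 \<le> r" using r by (auto simp: fires_def)
  \<comment> \<open>\<open>A t\<close> collects the oscillators whose spikes arrive during
    \<open>(r, t]\<close>; their total strength \<open>W t\<close> bounds the advance over the free
    run.\<close>
  define A where "A t = {k. \<exists>u. r - \<tau> < u \<and> u \<le> t - \<tau> \<and> fires \<phi> k u}" for t
  define W where "W t = (\<Sum>k\<in>A t. eps k i)" for t
  have A_mono: "A t \<subseteq> A u" if "t \<le> u" for t u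
    using that by (force simp: A_def)
  have W_mono: "W t \<le> W u" if "t \<le> u" for t u
    unfolding W_def using A_mono[OF that] by (intro sum_mono2 eps_nonneg) auto
  have W_nonneg: "0 \<le> W t" for t
    unfolding W_def by (intro sum_nonneg eps_nonneg)
  have "f (\<phi> i b) \<le> f (b - r) + W b"
  proof (rule driven_comparison[OF rise \<open>r < b\<close> driven_free_run[OF rise] driven_phase])
    show "eventually (\<lambda>t. f (\<phi> i t) \<le> f (t - r) + W t) (at_right r)"
      using eventually_free_run[OF \<open>0 \<le> r\<close>, of i]
      by eventually_elim (use r W_nonneg in auto)
    show "eventually (\<lambda>u. W t \<le> W u) (at_right t)" for t
      using W_mono by (auto simp: eventually_at_right_field intro!: exI[of _ "t + 1"])
    fix t assume t: "r < t" "t \<le> b"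
    have "W u + input i t \<le> W t + 0" if u: "u < t" for u
    proof -
      \<comment> \<open>By \<open>once\<close>, the senders arriving at \<open>t\<close> are new, so
        no strength is counted twice in \<open>W t\<close>.\<close>
      have "\<not> fires \<phi> k (t - \<tau>)" if "k \<in> A u" for k
      proof -
        obtain p where "r - \<tau> < p" "p \<le> u - \<tau>" "fires \<phi> k p"
          using \<open>k \<in> A u\<close> by (auto simp: A_def)
        then show ?thesis
          using once[of p "t - \<tau>" k] t u by auto
      qed
      then have "W u + input i t = (\<Sum>k\<in>A u \<union> {k. fires \<phi> k (t - \<tau>)}. eps k i)"
        unfolding W_def input_def by (intro sum.union_disjoint[symmetric]) auto
      moreover have "{k. fires \<phi> k (t - \<tau>)} \<subseteq> A t"
        using t unfolding A_def by (auto intro!: exI[of _ "t - \<tau>"])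
      then have "(\<Sum>k\<in>A u \<union> {k. fires \<phi> k (t - \<tau>)}. eps k i) \<le> W t"
        unfolding W_def using A_mono[of u t] u by (intro sum_mono2 eps_nonneg) auto
      ultimately show ?thesis by simp
    qed
    then show "eventually (\<lambda>u. W u + input i t \<le> W t + 0) (at_left t)"
      by (auto simp: eventually_at_left_field intro!: exI[of _ "t - 1"])
  qed (use \<open>b \<le> r + \<tau>\<close> delay \<open>0 \<le> r\<close> quiet W_nonneg r in auto)
  also have "W b \<le> \<epsilon>"
    unfolding W_def sum_eps[of i, symmetric] by (intro sum_mono2 eps_nonneg) auto
  also have "f (b - r) \<le> f \<tau>"
    using \<open>b \<le> r + \<tau>\<close> delay r by (intro rise_function_mono[OF rise]) auto
  finally have "f 1 < 1"
    using weak r by (auto simp: fires_def)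
  then show False
    using rise by (auto simp: rise_function_def)
qed

text \<open>The condition \<open>once\<close> of \<open>consecutive_gap\<close> only concerns
  firings at least one delay earlier. This permits induction on the number of delays that cover
  \<open>[0, v]\<close>.\<close>

lemma firing_gap:
  assumes "fires \<phi> k u" "fires \<phi> k v" "u < v"
  shows "\<tau> < v - u"
proof -
  have "\<forall>k u v. fires \<phi> k u \<longrightarrow> fires \<phi> k v \<longrightarrow> u < v \<longrightarrow> v \<le> real n * \<tau> \<longrightarrow> \<tau> < v - u" for n
  proof (induction n)
    case 0
    then show ?case by (auto simp: fires_def)
  next
    case (Suc n)
    show ?case
    proof (intro allI impI)
      fix k u v
      assume uv: "fires \<phi> k u" "fires \<phi> k v" "u < v" "v \<le> real (Suc n) * \<tau>"
      obtain b where b: "u < b" "b \<le> v" "fires \<phi> k b"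
        "\<And>t. u < t \<Longrightarrow> t < b \<Longrightarrow> \<not> fires \<phi> k t"
        using next_firing[OF uv(2,3)] by metis
      show "\<tau> < v - u"
      proof (rule ccontr)
        assume short: "\<not> \<tau> < v - u"
        \<comment> \<open>Under \<open>short\<close> the emission window has length at most
          \<open>\<tau>\<close>, and it ends by \<open>real n * \<tau>\<close>, so the induction
          hypothesis forbids two firings of one oscillator in it.\<close>
        have "\<tau> < b - u"
        proof (rule consecutive_gap[OF uv(1) b(3,1,4)])
          fix l p q
          assume pq: "u - \<tau> < p" "p < q" "q \<le> b - \<tau>" "fires \<phi> l p"
          show "\<not> fires \<phi> l q"
          proof
            assume "fires \<phi> l q"
            moreover have "q \<le> real n * \<tau>"
              using pq uv b by (auto simp: algebra_simps)
            ultimately have "\<tau> < q - p"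
              using Suc.IH pq by blast
            then show False using pq b short by auto
          qed
        qed
        then show False using b short by auto
      qed
    qed
  qed
  moreover obtain n where "v / \<tau> \<le> real n"
    using real_arch_simple by blast
  then have "v \<le> real n * \<tau>"
    using delay by (simp add: field_simps)
  ultimately show ?thesis using assms by blast
qed

subsection \<open>Numbering of the firings\<close>

lemma firing_count_strict_mono:
  assumes "fires \<phi> i t" "s < t"
  shows "card {u. fires \<phi> i u \<and> u \<le> s} < card {u. fires \<phi> i u \<and> u \<le> t}"
proof (rule psubset_card_mono[OF finite_firings])
  let ?F = "\<lambda>s. {u. fires \<phi> i u \<and> u \<le> s}"
  have "t \<in> ?F t" "t \<notin> ?F s" "?F s \<subseteq> ?F t"
    using assms by auto
  then show "?F s \<subset> ?F t" by blast
qed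

text \<open>Provides existence for the definite description in \<open>firing_time\<close>: every
  firing is followed by another, and the earliest later one raises the count by exactly one.\<close>

lemma ex_firing_count: "\<exists>t. fires \<phi> i t \<and> card {s. fires \<phi> i s \<and> s \<le> t} = Suc m"
proof (induction m)
  case 0
  obtain s where "fires \<phi> i s" "0 < s"
    using fires_within_unit_time[of 0 i] by blast
  \<comment> \<open>Searching from \<open>-1\<close> instead of 0 includes a possible firing at time
    0.\<close>
  moreover from this have "-1 < s" by simp
  ultimately obtain b where b: "fires \<phi> i b" "\<And>t. -1 < t \<Longrightarrow> t < b \<Longrightarrow> \<not> fires \<phi> i t"
    using next_firing[of i s "-1"] by metis
  have "0 \<le> s" if "fires \<phi> i s" for s
    using that by (auto simp: fires_def)
  then have "{s. fires \<phi> i s \<and> s \<le> b} = {b}"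
    using b by (force simp: set_eq_iff)
  then show ?case using b(1) by auto
next
  case (Suc m)
  then obtain t where t: "fires \<phi> i t" "card {s. fires \<phi> i s \<and> s \<le> t} = Suc m"
    by blast
  moreover from this have "0 \<le> t" by (simp add: fires_def)
  ultimately obtain s where "fires \<phi> i s" "t < s"
    using fires_within_unit_time[of t i] by blast
  then obtain b where b: "t < b" "fires \<phi> i b" "\<And>u. t < u \<Longrightarrow> u < b \<Longrightarrow> \<not> fires \<phi> i u"
    using next_firing[of i s t] by metis
  have "{s. fires \<phi> i s \<and> s \<le> b} = insert b {s. fires \<phi> i s \<and> s \<le> t}"
  proof (intro equalityI subsetI)
    fix s assume "s \<in> {s. fires \<phi> i s \<and> s \<le> b}"
    then show "s \<in> insert b {s. fires \<phi> i s \<and> s \<le> t}"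
      using b(3)[of s] by (cases "s < b"; cases "t < s") auto
  qed (use b in auto)
  then show ?case
    using t b finite_firings by (intro exI[of _ b]) auto
qed

lemma firing_time:
  assumes "m \<ge> 1"
  shows "fires \<phi> i (firing_time \<phi> i m)"
    and "card {s. fires \<phi> i s \<and> s \<le> firing_time \<phi> i m} = m"
proof -
  have "\<exists>!t. fires \<phi> i t \<and> card {s. fires \<phi> i s \<and> s \<le> t} = m"
  proof (rule ex_ex1I)
    show "\<exists>t. fires \<phi> i t \<and> card {s. fires \<phi> i s \<and> s \<le> t} = m"
      using ex_firing_count[of i "m - 1"] assms by auto
    show "t = u" if "fires \<phi> i t \<and> card {s. fires \<phi> i s \<and> s \<le> t} = m"
      "fires \<phi> i u \<and> card {s. fires \<phi> i s \<and> s \<le> u} = m" for t u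
      using that firing_count_strict_mono[of i t u] firing_count_strict_mono[of i u t]
      by (cases t u rule: linorder_cases) auto
  qed
  from theI'[OF this] show "fires \<phi> i (firing_time \<phi> i m)"
      "card {s. fires \<phi> i s \<and> s \<le> firing_time \<phi> i m} = m"
    by (simp_all add: firing_time_def)
qed

lemma firing_time_less_Suc:
  assumes "m \<ge> 1"
  shows "firing_time \<phi> i m < firing_time \<phi> i (m + 1)"
proof (rule ccontr)
  assume "\<not> ?thesis"
  then have "card {s. fires \<phi> i s \<and> s \<le> firing_time \<phi> i (m + 1)} \<le>
      card {s. fires \<phi> i s \<and> s \<le> firing_time \<phi> i m}"
    by (intro card_mono finite_firings) auto
  then show False
    using firing_time(2)[of m i] firing_time(2)[of "m + 1" i] assms by auto
qed

lemma no_fire_between_firing_times: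
  assumes "m \<ge> 1" "firing_time \<phi> i m < t" "t < firing_time \<phi> i (m + 1)"
  shows "\<not> fires \<phi> i t"
proof
  assume "fires \<phi> i t"
  then show False
    using firing_count_strict_mono[of i t "firing_time \<phi> i m"]
      firing_count_strict_mono[of i "firing_time \<phi> i (m + 1)" t]
      firing_time[of m i] firing_time[of "m + 1" i] assms by auto
qed

subsection \<open>Order preservation\<close>

text \<open>Isolates the spikes exchanged by \<open>i\<close> and \<open>j\<close>; under the
  symmetry hypotheses the remaining sum is the same for \<open>l = i\<close> and
  \<open>l = j\<close>.\<close>

lemma input_split:
  assumes "i \<noteq> j"
  shows "input l t = (if fires \<phi> i (t - \<tau>) then eps i l else 0)
      + (if fires \<phi> j (t - \<tau>) then eps j l else 0)
      + (\<Sum>k | fires \<phi> k (t - \<tau>) \<and> k \<notin> {i, j}. eps k l)"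
proof -
  let ?g = "\<lambda>k. if fires \<phi> k (t - \<tau>) then eps k l else 0"
  have "input l t = (\<Sum>k\<in>UNIV. ?g k)"
    by (simp add: input_def sum.If_cases)
  also have "\<dots> = (\<Sum>k\<in>{i, j}. ?g k) + (\<Sum>k\<in>- {i, j}. ?g k)"
    using sum.subset_diff[of "{i, j}" UNIV ?g] by (simp add: Compl_eq_Diff_UNIV add.commute)
  also have "(\<Sum>k\<in>- {i, j}. ?g k) = (\<Sum>k | fires \<phi> k (t - \<tau>) \<and> k \<notin> {i, j}. eps k l)"
    by (rule sum.mono_neutral_cong_right) auto
  finally show ?thesis using assms by simp
qed

lemma self_coupling: "eps i i = 0"
  using network by (auto simp: coupling_network_def)

text \<open>If \<open>i\<close> were silent on \<open>(r, s']\<close>, comparison on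
  \<open>(s, s']\<close> would put \<open>i\<close> at phase 1 when \<open>j\<close> fires at
  \<open>s'\<close>, so \<open>i\<close> would fire there too.\<close>

lemma leader_fires_first:
  assumes "i \<noteq> j" and sym: "eps i j = eps j i"
    and common: "\<And>k. k \<notin> {i, j} \<Longrightarrow> eps k i = eps k j"
    and r: "fires \<phi> i r" and s: "fires \<phi> j s" "fires \<phi> j s'" "s < s'" and "r \<le> s"
    and quiet_j: "\<And>t. s < t \<Longrightarrow> t < s' \<Longrightarrow> \<not> fires \<phi> j t"
  shows "\<exists>t. r < t \<and> t \<le> s' \<and> fires \<phi> i t"
proof (rule ccontr)
  assume "\<not> ?thesis"
  then have quiet_i: "\<And>t. r < t \<Longrightarrow> t \<le> s' \<Longrightarrow> \<not> fires \<phi> i t"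
    by blast
  have "0 \<le> s" using s by (auto simp: fires_def)
  have "s + \<tau> < s'"
    using firing_gap[OF s] by simp
  \<comment> \<open>The advance of \<open>j\<close> is due to the spike from \<open>i\<close>, arriving at \<open>r + \<tau>\<close>, until the equally strong
    spike from \<open>j\<close> reaches \<open>i\<close> at \<open>s + \<tau>\<close>.\<close>
  define C where "C t = (if r + \<tau> \<le> t \<and> t < s + \<tau> then eps i j else 0)" for t
  have C_nonneg: "0 \<le> C t" for t
    using eps_nonneg by (auto simp: C_def)
  \<comment> \<open>By \<open>firing_gap\<close>, any spike of \<open>i\<close> emitted before
    \<open>r\<close> arrives before \<open>r \<le> s\<close>; silence after \<open>r\<close>
    excludes later ones.\<close>
  have from_i: "fires \<phi> i (t - \<tau>) \<longleftrightarrow> t = r + \<tau>" if "s < t" "t \<le> s'" for t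
  proof
    assume fire: "fires \<phi> i (t - \<tau>)"
    then have "\<not> r < t - \<tau>"
      using quiet_i[of "t - \<tau>"] that delay by auto
    moreover have "\<not> t - \<tau> < r"
      using firing_gap[OF fire r] that \<open>r \<le> s\<close> by auto
    ultimately show "t = r + \<tau>" by auto
  qed (use r in auto)
  have from_j: "fires \<phi> j (t - \<tau>) \<longleftrightarrow> t = s + \<tau>" if "s < t" "t \<le> s'" for t
  proof
    assume fire: "fires \<phi> j (t - \<tau>)"
    then have "\<not> s < t - \<tau>"
      using quiet_j[of "t - \<tau>"] that delay by auto
    moreover have "\<not> t - \<tau> < s"
      using firing_gap[OF fire s(1)] that by auto
    ultimately show "t = s + \<tau>" by auto
  qed (use s in auto)
  have "f (\<phi> j s') \<le> f (\<phi> i s') + C s'"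
  proof (rule driven_comparison[OF rise \<open>s < s'\<close> driven_phase driven_phase])
    show "eventually (\<lambda>t. f (\<phi> j t) \<le> f (\<phi> i t) + C t) (at_right s)"
      using eventually_free_run[OF \<open>0 \<le> s\<close>, of i] eventually_free_run[OF \<open>0 \<le> s\<close>, of j]
        eventually_at_right_real[of s "s + 1", simplified]
    proof eventually_elim
      case (elim t)
      \<comment> \<open>\<open>j\<close> has just been reset to 0, so it cannot start ahead, even if
        \<open>i\<close> is reset at the same instant.\<close>
      have "\<phi> j t \<le> \<phi> i t"
        using elim s phase_bounds[OF \<open>0 \<le> s\<close>, of i] by auto
      then have "f (\<phi> j t) \<le> f (\<phi> i t)"
        using elim \<open>0 \<le> s\<close> phase_bounds[of t i] phase_bounds[of t j]
        by (intro rise_function_mono[OF rise]) auto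
      then show ?case using C_nonneg[of t] by auto
    qed
  next
    fix t assume t: "s < t" "t < s'"
    show "eventually (\<lambda>u. C t \<le> C u) (at_right t)"
    proof (cases "t < s + \<tau>")
      case True
      show ?thesis
        using eventually_at_right_real[OF True]
        by eventually_elim (use eps_nonneg in \<open>auto simp: C_def\<close>)
    next
      case False
      then have "C t = 0" by (simp add: C_def)
      then show ?thesis using C_nonneg by simp
    qed
  next
    fix t assume t: "s < t" "t \<le> s'"
    have "input j t - input i t
        = (if t = r + \<tau> then eps i j else 0) - (if t = s + \<tau> then eps i j else 0)"
      unfolding input_split[OF \<open>i \<noteq> j\<close>] from_i[OF t] from_j[OF t]
      using common sym by (simp add: self_coupling)
    \<comment> \<open>\<open>C\<close> jumps up at \<open>r + \<tau>\<close> and down at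
      \<open>s + \<tau>\<close>, matching the input difference. For \<open>r = s\<close> the jumps
      cancel and \<open>C\<close> vanishes.\<close>
    moreover have "eventually (\<lambda>u. C u + (if t = r + \<tau> then eps i j else 0)
        \<le> C t + (if t = s + \<tau> then eps i j else 0)) (at_left t)"
    proof (cases "s + \<tau> < t")
      case True
      show ?thesis
        using eventually_at_left_real[OF True]
        by eventually_elim (use True \<open>r \<le> s\<close> in \<open>auto simp: C_def\<close>)
    next
      case False
      show ?thesis
        using eventually_at_left_real[OF t(1)]
        by eventually_elim (use False eps_nonneg \<open>r \<le> s\<close> in \<open>auto simp: C_def\<close>)
    qed
    ultimately show "eventually (\<lambda>u. C u + input j t \<le> C t + input i t) (at_left t)"
      by (auto elim!: eventually_mono)
  qed (use \<open>0 \<le> s\<close> \<open>r \<le> s\<close> \<open>s < s'\<close> quiet_i quiet_j C_nonneg in auto)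
  \<comment> \<open>The firing gap of \<open>j\<close> ensures that its compensating spike has
    reached \<open>i\<close> before \<open>s'\<close>.\<close>
  moreover have "C s' = 0"
    using \<open>s + \<tau> < s'\<close> by (simp add: C_def)
  moreover have "\<phi> j s' = 1" "f 1 = 1"
    using s rise by (auto simp: fires_def rise_function_def)
  ultimately have "\<not> \<phi> i s' < 1"
    using rise_function_strict_mono[OF rise, of "\<phi> i s'" 1] phase_bounds[of s' i] s \<open>0 \<le> s\<close> by auto
  then have "fires \<phi> i s'"
    using phase_bounds[of s' i] s \<open>0 \<le> s\<close> by (auto simp: fires_def)
  then show False
    using quiet_i[of s'] s \<open>r \<le> s\<close> by auto
qed

end

theorem mainTheorem3:
  fixes f :: "real \<Rightarrow> real"
    and Pre :: "'n::finite \<Rightarrow> 'n set"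
    and eps :: "'n \<Rightarrow> 'n \<Rightarrow> real"
    and \<epsilon> \<tau> :: real
    and i j :: 'n
    and \<phi> :: "'n \<Rightarrow> real \<Rightarrow> real"
    and m_i m_j :: nat
  assumes "rise_function f"
    and "coupling_network Pre eps \<epsilon>"
    and "0 < \<tau>" and "\<tau> < 1"
    and "0 < \<epsilon>" and "\<epsilon> < 1"
    and "f \<tau> + \<epsilon> < 1"
    and "i \<noteq> j"
    and "eps i j = eps j i"
    and "\<And>k. k \<notin> {i, j} \<Longrightarrow> eps k i = eps k j"
    and "is_solution f Pre eps \<tau> \<phi>"
    and "m_i \<ge> 1" and "m_j \<ge> 1"
    and "firing_time \<phi> i m_i \<le> firing_time \<phi> j m_j"
  shows "firing_time \<phi> i (m_i + 1) \<le> firing_time \<phi> j (m_j + 1)"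
proof -
  interpret oscillator_solution f Pre eps \<epsilon> \<tau> \<phi>
    by unfold_locales (use assms in auto)
  have "\<exists>t. firing_time \<phi> i m_i < t \<and> t \<le> firing_time \<phi> j (m_j + 1) \<and> fires \<phi> i t"
    using assms(8-10,12-14) firing_time(1)[of m_i i] firing_time(1)[of m_j j]
      firing_time(1)[of "m_j + 1" j]
    by (intro leader_fires_first[where s = "firing_time \<phi> j m_j"]
        firing_time_less_Suc no_fire_between_firing_times[of m_j]) auto
  then obtain t where "firing_time \<phi> i m_i < t" "t \<le> firing_time \<phi> j (m_j + 1)" "fires \<phi> i t"
    by blast
  \<comment> \<open>This firing of \<open>i\<close> comes after number \<open>m_i\<close>, hence not
    before number \<open>m_i + 1\<close>.\<close>
  then show ?thesis
    using no_fire_between_firing_times[OF \<open>m_i \<ge> 1\<close>, of i t] by fastforce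
qed

end
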